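(* Let $q-1=\ell s$ with $\ell,s$ positive integers, let $r_0,\ldots,r_{\ell-1}$ be positive integers, let $f_0(x),\ldots,f_{\ell-1}(x)\in\mathbb{F}_q[x]$, and define $P:\mathbb{F}_q\to\mathbb{F}_q$ by $P(0)=0$ and $P(x)=x^{r_i}f_i(x^s)$ if $x\in C_i$, for $0\le i\le\ell-1$. Suppose $f_i(\zeta^i)^s=A\zeta^{n_i}$ for each $i=0,\ldots,\ell-1$, where $A\in\mathbb{F}_q^*$ is a constant and the $n_i$ are integers. Then $P(x)$ is a permutation polynomial of $\mathbb{F}_q$ if and only if (i) $\gcd(r_i,s)=1$ for all $i=0,\ldots,\ell-1$; and (ii) $\{ir_i+n_i\mid i=0,\ldots,\ell-1\}$ is a complete set of residues modulo $\ell$. In particular, if $f_i(\zeta^i)^s=A$ for each $i=0,\ldots,\ell-1$ and a constant $A\in\mathbb{F}_q^*$, then $P$ is a permutation polynomial of $\mathbb{F}_q$ if and only if $\gcd(r_i,s)=1$ for $i=0,\ldots,\ell-1$ and $\{r_ii\mid i=0,\ldots,\ell-1\}$ is a complete set of residues modulo $\ell$.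
   Context: $q$ is a prime power, $\gamma$ a fixed primitive element (generator of $\mathbb{F}_q^*$). $C_0=\{\gamma^{\ell j}: 0\le j\le s-1\}$ and $C_i=\gamma^iC_0$ for $0\le i\le\ell-1$ are the cyclotomic cosets. $\zeta=\gamma^s$ is a primitive $\ell$-th root of unity. A map (or polynomial) is a permutation polynomial (PP) of $\mathbb{F}_q$ if it induces a bijection of $\mathbb{F}_q$. *)

theory Defs
  imports
    "HOL-Computational_Algebra.Polynomial"
    "HOL-Library.Cardinality"
    "HOL-Number_Theory.Cong"
begin

text \<open>Finite fields are types of class \<open>{field, finite}\<close>; the order of such a field is \<open>CARD('a)\<close>.\<close>

definition primitive_element :: "'a::field \<Rightarrow> bool" where
  "primitive_element \<gamma> \<longleftrightarrow> range (\<lambda>k::nat. \<gamma> ^ k) = UNIV - {0}"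

definition cyclotomic_subgroup :: "'a::field \<Rightarrow> nat \<Rightarrow> nat \<Rightarrow> 'a set" where
  "cyclotomic_subgroup \<gamma> l s = (\<lambda>j. \<gamma> ^ (l * j)) ` {0..s - 1}"

definition cyclotomic_coset :: "'a::field \<Rightarrow> nat \<Rightarrow> nat \<Rightarrow> nat \<Rightarrow> 'a set" where
  "cyclotomic_coset \<gamma> l s i = (\<lambda>y. \<gamma> ^ i * y) ` cyclotomic_subgroup \<gamma> l s"

text \<open>This is a condition on the set only. An indexed family of \<open>m\<close> integers whose set of
  values is complete modulo \<open>m\<close> has pairwise incongruent members, by counting.\<close>

definition complete_residues :: "nat \<Rightarrow> int set \<Rightarrow> bool" where
  "complete_residues m S \<longleftrightarrow> (\<forall>x::int. \<exists>!y. y \<in> S \<and> [y = x] (mod int m))"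

end

theory Submission
  imports Defs
begin

text \<open>For \<open>x \<in> C\<^sub>i\<close> one has \<open>x\<^sup>s = \<zeta>\<^sup>i\<close>, so \<open>P x\<close> is \<open>f\<^sub>i(\<zeta>\<^sup>i)\<close> times the \<open>r\<^sub>i\<close>-th power
  of \<open>x\<close>, and \<open>(P x)\<^sup>s = A \<zeta>\<^sup>e\<close> with \<open>e = i r\<^sub>i + n\<^sub>i\<close>. Thus \<open>P\<close> sends each coset into a coset of
  \<open>C\<^sub>0\<close> that is determined by \<open>e\<close> modulo \<open>\<ell>\<close>. Condition (ii) says that this action on cosets is
  bijective, condition (i) that \<open>P\<close> is injective on each coset.\<close>

section \<open>Complete residue systems\<close>

text \<open>Pigeonhole: the \<open>m\<close> residues lie in a set of \<open>m\<close> elements, so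
  they are distinct exactly when every class is met. The surjective form suits the passage from
  \<open>bij P\<close> to condition (ii), the injective form the converse.\<close>

lemma complete_residues_iff:
  fixes g :: "nat \<Rightarrow> int"
  assumes "m > 0"
  shows "complete_residues m {g i | i. i < m} \<longleftrightarrow> inj_on (\<lambda>i. g i mod int m) {..<m}"
    and "complete_residues m {g i | i. i < m} \<longleftrightarrow> (\<forall>x. \<exists>i<m. [g i = x] (mod int m))"
proof -
  let ?h = "\<lambda>i. g i mod int m"
  have sub: "?h ` {..<m} \<subseteq> {0..<int m}"
    using assms by auto
  have inj_iff: "inj_on ?h {..<m} \<longleftrightarrow> ?h ` {..<m} = {0..<int m}"
  proof
    assume "inj_on ?h {..<m}"
    then have "card (?h ` {..<m}) = card {0..<int m}"
      by (simp add: card_image)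
    with sub show "?h ` {..<m} = {0..<int m}"
      by (intro card_subset_eq) auto
  next
    assume "?h ` {..<m} = {0..<int m}"
    then show "inj_on ?h {..<m}"
      by (intro eq_card_imp_inj_on) auto
  qed
  have surj_iff: "?h ` {..<m} = {0..<int m} \<longleftrightarrow> (\<forall>x. \<exists>i<m. [g i = x] (mod int m))"
  proof
    assume eq: "?h ` {..<m} = {0..<int m}"
    show "\<forall>x. \<exists>i<m. [g i = x] (mod int m)"
    proof
      fix x
      have "x mod int m \<in> ?h ` {..<m}"
        unfolding eq using assms by simp
      then show "\<exists>i<m. [g i = x] (mod int m)"
        by (auto simp: cong_def)
    qed
  next
    assume R: "\<forall>x. \<exists>i<m. [g i = x] (mod int m)"
    have "{0..<int m} \<subseteq> ?h ` {..<m}"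
    proof
      fix x assume x: "x \<in> {0..<int m}"
      obtain i where "i < m" "[g i = x] (mod int m)"
        using R by blast
      with x show "x \<in> ?h ` {..<m}"
        by (auto simp: cong_def intro!: image_eqI[of _ _ i])
    qed
    with sub show "?h ` {..<m} = {0..<int m}"
      by blast
  qed
  have "complete_residues m {g i | i. i < m} \<longleftrightarrow> (\<forall>x. \<exists>i<m. [g i = x] (mod int m))"
  proof
    assume "complete_residues m {g i | i. i < m}"
    then show "\<forall>x. \<exists>i<m. [g i = x] (mod int m)"
      unfolding complete_residues_def by blast
  next
    assume R: "\<forall>x. \<exists>i<m. [g i = x] (mod int m)"
    then have inj: "inj_on ?h {..<m}"
      using inj_iff surj_iff by blast
    \<comment> \<open>Uniqueness in \<open>complete_residues\<close> concerns values, not indices;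
      it follows because congruent values come from the same index.\<close>
    have "g i = g j" if "i < m" "j < m" "[g i = x] (mod int m)" "[g j = x] (mod int m)" for i j x
      using inj_onD[OF inj, of i j] that by (auto simp: cong_def)
    with R show "complete_residues m {g i | i. i < m}"
      unfolding complete_residues_def by blast
  qed
  with inj_iff surj_iff
  show "complete_residues m {g i | i. i < m} \<longleftrightarrow> inj_on ?h {..<m}"
    and "complete_residues m {g i | i. i < m} \<longleftrightarrow> (\<forall>x. \<exists>i<m. [g i = x] (mod int m))"
    by blast+
qed

section \<open>Orders and powers of field elements\<close>

text \<open>Carries the order of \<open>x\<close> from natural to integer exponents, since the
  \<open>n i\<close> may be negative. A negative exponent passes to the inverse, and divisibility
  ignores signs.\<close>

lemma power_int_eq_iff_cong:
  fixes x :: "'a::field"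
  assumes x: "x \<noteq> 0" and ord: "\<And>d. x ^ d = 1 \<longleftrightarrow> m dvd d"
  shows "x powi a = x powi b \<longleftrightarrow> [a = b] (mod int m)"
proof -
  have one: "x powi k = 1 \<longleftrightarrow> int m dvd k" for k
    using x ord by (simp add: power_int_def power_inverse int_dvd_int_iff dvd_nat_abs_iff)
      (metis int_dvd_int_iff dvd_minus_iff int_nat_eq linorder_not_le nat_0_le neg_0_le_iff_le
        order_less_imp_le)
  have "x powi a = x powi b \<longleftrightarrow> x powi (a - b) = 1"
    using x by (simp add: power_int_diff)
  also have "\<dots> \<longleftrightarrow> [a = b] (mod int m)"
    by (simp add: one cong_iff_dvd_diff)
  finally show ?thesis .
qed

lemma primitive_element_nonzero:
  "primitive_element \<gamma> \<Longrightarrow> \<gamma> \<noteq> 0"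
  unfolding primitive_element_def by (metis DiffD2 power_one_right rangeI singletonI)

text \<open>If \<open>\<gamma> ^ e = 1\<close> with \<open>e > 0\<close>, there are at most
  \<open>e\<close> powers, yet they exhaust the nonzero elements; so no such \<open>e\<close> is
  below \<open>m\<close>. Hence the first \<open>m\<close> powers are distinct and fill that set,
  and \<open>\<gamma> ^ m\<close> repeats one of them.\<close>

lemma primitive_element_power_eq_1_iff:
  fixes \<gamma> :: "'a::{field,finite}"
  assumes prim: "primitive_element \<gamma>"
  shows "\<gamma> ^ d = 1 \<longleftrightarrow> CARD('a) - 1 dvd d"
proof -
  define m where "m = CARD('a) - 1"
  have ran: "range (\<lambda>k::nat. \<gamma> ^ k) = UNIV - {0}"
    using prim by (simp add: primitive_element_def)
  have nz: "\<gamma> \<noteq> 0"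
    using prim by (rule primitive_element_nonzero)
  have card: "card (UNIV - {0::'a}) = m"
    by (simp add: m_def card_Diff_singleton)
  have reduce: "\<gamma> ^ (k mod e) = \<gamma> ^ k" if "\<gamma> ^ e = 1" for k e
  proof -
    have "\<gamma> ^ k = \<gamma> ^ (e * (k div e) + k mod e)"
      by simp
    also have "\<dots> = \<gamma> ^ (k mod e)"
      by (simp only: power_add power_mult that power_one mult_1_left)
    finally show ?thesis ..
  qed
  have min: "m \<le> e" if "\<gamma> ^ e = 1" "e > 0" for e
  proof -
    have "\<gamma> ^ k \<in> (\<lambda>k. \<gamma> ^ k) ` {..<e}" for k
      using that reduce[OF that(1), of k] by (intro image_eqI[of _ _ "k mod e"]) auto
    then have "UNIV - {0} \<subseteq> (\<lambda>k. \<gamma> ^ k) ` {..<e}"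
      unfolding ran[symmetric] by blast
    then have "card (UNIV - {0::'a}) \<le> card {..<e}"
      by (rule surj_card_le[rotated]) simp
    then show ?thesis
      by (simp add: card)
  qed
  have diff: "\<gamma> ^ (b - a) = 1" if "\<gamma> ^ a = \<gamma> ^ b" "a \<le> b" for a b :: nat
    using that nz by (simp add: power_diff)
  have inj: "inj_on (\<lambda>k. \<gamma> ^ k) {..<m}"
  proof (rule linorder_inj_onI')
    fix a b :: nat
    assume "a \<in> {..<m}" "b \<in> {..<m}" "a < b"
    then show "\<gamma> ^ a \<noteq> \<gamma> ^ b"
      using diff[of a b] min[of "b - a"] by auto
  qed
  have all: "(\<lambda>k. \<gamma> ^ k) ` {..<m} = UNIV - {0}"
    using nz by (intro card_subset_eq) (auto simp: card card_image[OF inj])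
  have "\<gamma> ^ m \<in> (\<lambda>k. \<gamma> ^ k) ` {..<m}"
    unfolding all using nz by simp
  then obtain k where k: "k < m" "\<gamma> ^ k = \<gamma> ^ m"
    by auto
  \<comment> \<open>The repeated power is \<open>\<gamma> ^ 0\<close>: for \<open>k > 0\<close>,
    \<open>m - k\<close> would be a positive exponent below \<open>m\<close> with power 1, against
    \<open>min\<close>.\<close>
  then have m1: "\<gamma> ^ m = 1"
    using diff[of k m] min[of "m - k"] by (cases "k = 0") auto
  have "\<gamma> ^ d = 1 \<longleftrightarrow> m dvd d"
  proof
    assume "\<gamma> ^ d = 1"
    then have "\<gamma> ^ (d mod m) = 1"
      using reduce[OF m1] by simp
    then have "d mod m = 0"
      using min[of "d mod m"] k(1) by (metis gr0I leD less_zeroE mod_less_divisor)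
    then show "m dvd d"
      by auto
  next
    assume "m dvd d"
    then show "\<gamma> ^ d = 1"
      by (auto simp: power_mult m1)
  qed
  then show ?thesis
    by (simp add: m_def)
qed

lemma primitive_element_subpower_eq_1_iff:
  fixes \<gamma> :: "'a::{field,finite}"
  assumes "primitive_element \<gamma>" "CARD('a) - 1 = l * s" "s > 0"
  shows "(\<gamma> ^ s) ^ d = 1 \<longleftrightarrow> l dvd d"
  using assms by (simp add: primitive_element_power_eq_1_iff mult.commute[of l] flip: power_mult)

lemma primitive_element_exhaust:
  assumes "primitive_element \<gamma>" "x \<noteq> 0"
  obtains k :: nat where "x = \<gamma> ^ k"
  using assms unfolding primitive_element_def by (metis DiffI UNIV_I imageE singletonD)

section \<open>Cyclotomic cosets\<close>

text \<open>The \<open>s\<close>-th power kills every \<open>\<gamma> ^ (l * j)\<close>, so it is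
  constant on each coset, and it separates cosets because \<open>\<gamma> ^ s\<close> has order
  \<open>l\<close>. Coset membership thus becomes an equation.\<close>

lemma mem_cyclotomic_coset_iff:
  fixes \<gamma> :: "'a::{field,finite}"
  assumes prim: "primitive_element \<gamma>" and card: "CARD('a) - 1 = l * s"
    and s: "s > 0" and i: "i < l"
  shows "x \<in> cyclotomic_coset \<gamma> l s i \<longleftrightarrow> x ^ s = (\<gamma> ^ s) ^ i"
proof
  have nz: "\<gamma> \<noteq> 0"
    using prim by (rule primitive_element_nonzero)
  have one: "\<gamma> ^ (l * s) = 1"
    using primitive_element_power_eq_1_iff[OF prim] card by simp
  {
    assume "x \<in> cyclotomic_coset \<gamma> l s i"
    then obtain j where "x = \<gamma> ^ i * \<gamma> ^ (l * j)"
      unfolding cyclotomic_coset_def cyclotomic_subgroup_def by auto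
    then have "x ^ s = (\<gamma> ^ s) ^ i * (\<gamma> ^ (l * s)) ^ j"
      by (simp add: power_mult_distrib mult_ac flip: power_mult)
    then show "x ^ s = (\<gamma> ^ s) ^ i"
      by (simp add: one)
  }
  assume eq: "x ^ s = (\<gamma> ^ s) ^ i"
  then have "x \<noteq> 0"
    using nz s by (auto simp: zero_power)
  with prim obtain k where k: "x = \<gamma> ^ k"
    by (rule primitive_element_exhaust)
  have "(\<gamma> ^ s) powi int k = (\<gamma> ^ s) powi int i"
    using eq by (simp add: k mult.commute flip: power_mult)
  then have "[int k = int i] (mod int l)"
    using nz primitive_element_subpower_eq_1_iff[OF prim card s]
    by (subst (asm) power_int_eq_iff_cong) auto
  then have ki: "k mod l = i"
    using i unfolding cong_int_iff by (simp add: cong_def)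
  \<comment> \<open>The subgroup is listed with \<open>j < s\<close> only; reducing modulo
    \<open>s\<close> drops a multiple of \<open>l * s\<close> from the exponent, which
    \<open>one\<close> turns into a factor 1.\<close>
  define j where "j = (k div l) mod s"
  have "k = i + l * j + l * s * (k div l div s)"
  proof -
    have "k = i + l * (k div l)"
      using ki mult_div_mod_eq[of l k] by linarith
    also have "k div l = j + s * (k div l div s)"
      by (simp add: j_def)
    finally show ?thesis
      by (simp add: algebra_simps)
  qed
  then have "x = \<gamma> ^ i * \<gamma> ^ (l * j)"
    unfolding k by (metis power_add power_mult one power_one mult_1_right)
  moreover have "j \<in> {0..s - 1}"
    using s by (simp add: j_def flip: less_Suc_eq_le)
  ultimately show "x \<in> cyclotomic_coset \<gamma> l s i"
    unfolding cyclotomic_coset_def cyclotomic_subgroup_def by blast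
qed

section \<open>The permutation criterion\<close>

text \<open>By Bezout, a multiple of \<open>a\<close> and a multiple of \<open>b\<close> differ by
  exactly 1, and both give the power 1.\<close>

lemma power_eq_1_coprime:
  fixes z :: "'a::field"
  assumes "z ^ a = 1" "z ^ b = 1" "gcd a b = 1" "a > 0"
  shows "z = 1"
proof -
  obtain x y where "a * x = b * y + 1"
    using bezout_nat[of a b] assms by auto
  then have "(z ^ a) ^ x = (z ^ b) ^ y * z"
    by (simp flip: power_mult)
  then show ?thesis
    using assms by simp
qed

lemma bij_cyclotomic_mapping_iff:
  fixes \<gamma> \<zeta> A :: "'a::{field,finite}" and n :: "nat \<Rightarrow> int"
  assumes prim: "primitive_element \<gamma>"
    and l: "l > 0" and s: "s > 0"
    and card: "CARD('a) - 1 = l * s"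
    and \<zeta>: "\<zeta> = \<gamma> ^ s"
    and r: "\<And>i. i < l \<Longrightarrow> r i > 0"
    and P0: "P 0 = 0"
    and P: "\<And>i x. i < l \<Longrightarrow> x \<in> cyclotomic_coset \<gamma> l s i \<Longrightarrow> P x = x ^ r i * poly (f i) (x ^ s)"
    and A: "A \<noteq> 0"
    and f: "\<And>i. i < l \<Longrightarrow> poly (f i) (\<zeta> ^ i) ^ s = A * \<zeta> powi n i"
  shows "bij P \<longleftrightarrow> (\<forall>i<l. gcd (r i) s = 1) \<and>
           complete_residues l {int (i * r i) + n i | i. i < l}"
proof -
  define c where "c i = poly (f i) (\<zeta> ^ i)" for i
  define e where "e i = int (i * r i) + n i" for i
  have nz: "\<gamma> \<noteq> 0" "\<zeta> \<noteq> 0"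
    using primitive_element_nonzero[OF prim] by (simp_all add: \<zeta>)
  have one_iff: "\<gamma> ^ d = 1 \<longleftrightarrow> l * s dvd d" for d
    using primitive_element_power_eq_1_iff[OF prim] card by simp
  have \<zeta>_one_iff: "\<zeta> ^ d = 1 \<longleftrightarrow> l dvd d" for d
    using primitive_element_subpower_eq_1_iff[OF prim card s] by (simp add: \<zeta>)
  have \<zeta>_eq: "\<zeta> powi a = \<zeta> powi b \<longleftrightarrow> [a = b] (mod int l)" for a b
    using nz \<zeta>_one_iff by (intro power_int_eq_iff_cong) auto
  have c: "c i ^ s = A * \<zeta> powi n i" if "i < l" for i
    using f[OF that] by (simp add: c_def)
  have c_nz: "c i \<noteq> 0" if "i < l" for i
    using c[OF that] A nz s by (auto simp: zero_power)
  have Px: "P x = x ^ r i * c i" if "i < l" "x ^ s = \<zeta> ^ i" for x i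
    using P[OF that(1), of x] mem_cyclotomic_coset_iff[OF prim card s that(1), of x] that
    by (simp add: c_def \<zeta>)
  have Ps: "P x ^ s = A * \<zeta> powi e i" if "i < l" "x ^ s = \<zeta> ^ i" for x i
  proof -
    have "P x ^ s = (x ^ s) ^ r i * c i ^ s"
      by (simp add: Px[OF that] power_mult_distrib mult.commute flip: power_mult)
    also have "\<dots> = A * (\<zeta> ^ (i * r i) * \<zeta> powi n i)"
      using that c by (simp add: power_mult)
    also have "\<dots> = A * \<zeta> powi e i"
      using nz by (simp add: e_def power_int_add del: of_nat_mult)
    finally show ?thesis .
  qed
  have coset: "\<exists>i<l. x ^ s = \<zeta> ^ i" if x: "x \<noteq> 0" for x
  proof -
    obtain k where k: "x = \<gamma> ^ k"
      using primitive_element_exhaust[OF prim x] .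
    \<comment> \<open>The coset of \<open>x\<close> is read off from its discrete logarithm
      \<open>k\<close> modulo \<open>l\<close>.\<close>
    have "\<zeta> powi int k = \<zeta> powi int (k mod l)"
      unfolding \<zeta>_eq by (simp add: cong_def zmod_int)
    then have "x ^ s = \<zeta> ^ (k mod l)"
      by (simp add: k \<zeta> mult.commute flip: power_mult)
    then show ?thesis
      using l by (intro exI[of _ "k mod l"]) simp
  qed
  have P_nz: "P x \<noteq> 0" if x: "x \<noteq> 0" for x
  proof -
    obtain i where "i < l" "x ^ s = \<zeta> ^ i"
      using coset[OF x] by blast
    then show ?thesis
      using Px c_nz x by simp
  qed
  show ?thesis
    unfolding e_def[symmetric]
  proof (intro iffI conjI allI impI)
    fix i assume bij: "bij P" and i: "i < l"
    define d where "d = gcd (r i) s"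
    obtain t where t: "s = d * t"
      unfolding d_def by (meson dvdE gcd_dvd2)
    obtain u where u: "r i = d * u"
      unfolding d_def by (meson dvdE gcd_dvd1)
    have dt: "d > 0" "t > 0"
      using s t by auto
    \<comment> \<open>\<open>z\<close> has order \<open>d\<close>, so multiplication by \<open>z\<close> preserves \<open>C\<^sub>i\<close> and the value of \<open>P\<close> there.\<close>
    define z where "z = \<gamma> ^ (l * t)"
    have "z ^ d = 1"
      unfolding z_def power_mult[symmetric] one_iff by (simp add: t mult_ac)
    then have "z ^ s = 1" "z ^ r i = 1"
      by (simp_all only: t u power_mult power_one)
    moreover have "(\<gamma> ^ i) ^ s = \<zeta> ^ i"
      by (simp add: \<zeta> mult.commute flip: power_mult)
    ultimately have "P (\<gamma> ^ i * z) = P (\<gamma> ^ i)"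
      using Px[OF i, of "\<gamma> ^ i * z"] Px[OF i, of "\<gamma> ^ i"] by (simp add: power_mult_distrib)
    then have "\<gamma> ^ i * z = \<gamma> ^ i"
      by (rule injD[OF bij_is_inj[OF bij]])
    \<comment> \<open>Now \<open>z = 1\<close>, so the order \<open>l * s\<close> of
      \<open>\<gamma>\<close> divides the exponent defining \<open>z\<close>. With
      \<open>s = d * t\<close> this leaves only \<open>d = 1\<close>.\<close>
    then have "l * s dvd l * t"
      using nz by (simp add: z_def one_iff)
    then have "s \<le> t"
      using l dt by (auto dest: dvd_imp_le)
    then have "d = 1"
      using t dt by simp
    then show "gcd (r i) s = 1"
      by (simp add: d_def)
  next
    assume bij: "bij P"
    have "\<exists>i<l. [e i = x] (mod int l)" for x
    proof -
      \<comment> \<open>A target in the coset belonging to exponent \<open>x\<close>: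
        \<open>c 0\<close> supplies \<open>A\<close> together with exponent \<open>n 0\<close>, and
        the power of \<open>\<gamma>\<close> corrects \<open>n 0\<close> to \<open>x\<close>. The
        coset of a preimage gives the required index.\<close>
      define w where "w = c 0 * \<gamma> powi (x - n 0)"
      have "w ^ s = c 0 ^ s * \<zeta> powi (x - n 0)"
        by (simp add: w_def \<zeta> power_mult_distrib power_int_power power_int_power' mult.commute)
      also have "\<dots> = A * \<zeta> powi x"
        using c[OF l] nz by (simp add: power_int_diff)
      finally have w: "w ^ s = A * \<zeta> powi x" .
      have "w \<noteq> 0"
        using c_nz[OF l] nz by (simp add: w_def)
      obtain y where y: "P y = w"
        using bij by (metis bij_pointE)
      then have "y \<noteq> 0"
        using P0 \<open>w \<noteq> 0\<close> by auto
      then obtain i where i: "i < l" "y ^ s = \<zeta> ^ i"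
        using coset by blast
      have "\<zeta> powi e i = \<zeta> powi x"
        using Ps[OF i] y w A by simp
      with i show ?thesis
        unfolding \<zeta>_eq by blast
    qed
    then show "complete_residues l {e i | i. i < l}"
      using complete_residues_iff(2)[OF l, of e] by blast
  next
    assume H: "(\<forall>i<l. gcd (r i) s = 1) \<and> complete_residues l {e i | i. i < l}"
    then have inj: "inj_on (\<lambda>i. e i mod int l) {..<l}"
      using complete_residues_iff(1)[OF l, of e] by blast
    \<comment> \<open>Injectivity suffices on a finite field. Equal nonzero images force equal
      cosets by (ii), then equal points by (i).\<close>
    have "inj P"
    proof (rule injI)
      fix x y assume eq: "P x = P y"
      show "x = y"
      proof (cases "x = 0 \<or> y = 0")
        case True
        then show ?thesis
          using eq P0 P_nz by metis
      next
        case False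
        then obtain i j where i: "i < l" "x ^ s = \<zeta> ^ i" and j: "j < l" "y ^ s = \<zeta> ^ j"
          using coset by meson
        have "\<zeta> powi e i = \<zeta> powi e j"
          using Ps[OF i] Ps[OF j] eq A by simp
        then have "e i mod int l = e j mod int l"
          unfolding \<zeta>_eq cong_def .
        then have ij: "i = j"
          using inj i j by (auto dest: inj_onD)
        have "x ^ r i = y ^ r i"
          using Px[OF i] Px[OF j] eq c_nz[OF i(1)] ij by simp
        \<comment> \<open>Points of one coset have equal \<open>s\<close>-th powers, so their
          quotient is a root of unity for both coprime exponents.\<close>
        then have "(x / y) ^ r i = 1" "(x / y) ^ s = 1"
          using i j ij False nz by (simp_all add: power_divide)
        then have "x / y = 1"
          using power_eq_1_coprime H i(1) r by blast
        then show ?thesis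
          using False by simp
      qed
    qed
    then show "bij P"
      by (simp add: bij_def finite_UNIV_inj_surj)
  qed
qed

theorem theorem3p2:
  fixes \<gamma> \<zeta> :: "'a::{field,finite}"
    and l s :: nat
    and r :: "nat \<Rightarrow> nat"
    and f :: "nat \<Rightarrow> 'a poly"
    and P :: "'a \<Rightarrow> 'a"
  assumes "primitive_element \<gamma>"
    and "l > 0" and "s > 0"
    and "CARD('a) - 1 = l * s"
    and "\<zeta> = \<gamma> ^ s"
    and "\<And>i. i < l \<Longrightarrow> r i > 0"
    and "P 0 = 0"
    and "\<And>i x. i < l \<Longrightarrow> x \<in> cyclotomic_coset \<gamma> l s i \<Longrightarrow> P x = x ^ r i * poly (f i) (x ^ s)"
  shows "(\<forall>(A::'a) (n::nat \<Rightarrow> int).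
            A \<noteq> 0 \<and> (\<forall>i<l. poly (f i) (\<zeta> ^ i) ^ s = A * \<zeta> powi n i) \<longrightarrow>
            (bij P \<longleftrightarrow>
              (\<forall>i<l. gcd (r i) s = 1) \<and>
              complete_residues l {int (i * r i) + n i | i. i < l})) \<and>
         (\<forall>A::'a.
            A \<noteq> 0 \<and> (\<forall>i<l. poly (f i) (\<zeta> ^ i) ^ s = A) \<longrightarrow>
            (bij P \<longleftrightarrow>
              (\<forall>i<l. gcd (r i) s = 1) \<and>
              complete_residues l {int (r i * i) | i. i < l}))"
proof -
  note iff = bij_cyclotomic_mapping_iff[where P = P and f = f, OF assms]
  show ?thesis
  proof (intro conjI allI impI; elim conjE)
    fix A :: 'a and n :: "nat \<Rightarrow> int"
    assume "A \<noteq> 0" "\<forall>i<l. poly (f i) (\<zeta> ^ i) ^ s = A * \<zeta> powi n i"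
    then show "bij P \<longleftrightarrow> (\<forall>i<l. gcd (r i) s = 1) \<and>
        complete_residues l {int (i * r i) + n i | i. i < l}"
      by (intro iff) auto
  next
    fix A :: 'a
    assume "A \<noteq> 0" "\<forall>i<l. poly (f i) (\<zeta> ^ i) ^ s = A"
    \<comment> \<open>The summand 0 is kept so that unification picks the zero function for
      \<open>n\<close>, where \<open>\<zeta> powi n i\<close> is 1.\<close>
    then have "bij P \<longleftrightarrow> (\<forall>i<l. gcd (r i) s = 1) \<and>
        complete_residues l {int (i * r i) + 0 | i. i < l}"
      by (intro iff) auto
    then show "bij P \<longleftrightarrow> (\<forall>i<l. gcd (r i) s = 1) \<and>
        complete_residues l {int (r i * i) | i. i < l}"
      by (simp add: mult.commute)
  qed
qed

end
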